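(* Let $\mathfrak g$ be one of the types $B^{(1)}_n$ $(n\ge3)$, $C^{(1)}_n$ $(n\ge2)$, $D^{(1)}_n$ $(n\ge4)$, $A^{(2)}_{2n}$ $(n\ge1)$, $A^{(2)\dagger}_{2n}$ $(n\ge1)$, $A^{(2)}_{2n-1}$ $(n\ge2)$, $D^{(2)}_{n+1}$ $(n\ge2)$. Let $L\ge0$, let $\lambda\in\mathbb Z^n$ be a dominant weight and let $\nu^\bullet$ be a $\lambda$-configuration for $L$, with vacancy numbers $P_i^{(a)}(\nu^\bullet)$ and with $m_i^{(a)}(\nu^\bullet)$ the multiplicity of $i$ as a part of $\nu^{(a)}$. The following are equivalent: 1. $P_i^{(a)}(\nu^\bullet)\ge0$ for all $a\in\{1,\dots,n\}$ and $i\in\upsilon_a\mathbb Z_{>0}$; 2. $P_i^{(a)}(\nu^\bullet)\ge0$ for all $a\in\{1,\dots,n\}$ and $i\in\upsilon_a\mathbb Z_{>0}$ such that $m_i^{(a)}(\nu^\bullet)>0$.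
   Context: $\lambda\in\mathbb Z^n$ is dominant if $\lambda_1\ge\dots\ge\lambda_n\ge0$ (for $D^{(1)}_n$: $\lambda_1\ge\dots\ge\lambda_n$ and $\lambda_{n-1}+\lambda_n\ge0$). Let $\upsilon_n=2$ for $C^{(1)}_n$, $\upsilon_n=\frac12$ for $B^{(1)}_n$, and $\upsilon_a=1$ in all other cases. $\nu^\bullet=(\nu^{(1)},\dots,\nu^{(n)})$, where $\nu^{(a)}$ is a finite multiset of parts from $\upsilon_a\mathbb Z_{>0}$; $|\nu^{(a)}|$ is the sum of the parts; $Q_i(\tau)=\sum_j\min(\tau_j,i)$ for a multiset $\tau=\{\tau_j\}$. Put $\nu^{(0)}=(1^L)$ ($L$ parts equal to $1$). $\nu^\bullet$ is a $\lambda$-configuration for $L$ if, with $S_a=\lambda_1+\cdots+\lambda_a$: - $C^{(1)}_n,A^{(2)}_{2n},A^{(2)\dagger}_{2n},D^{(2)}_{n+1}$: $|\nu^{(a)}|=L-S_a$ for $1\le a\le n$; - $B^{(1)}_n,A^{(2)}_{2n-1}$: $|\nu^{(a)}|=L-S_a$ for $a<n$, $|\nu^{(n)}|=\frac12(L-S_n)$; - $D^{(1)}_n$: $|\nu^{(a)}|=L-S_a$ for $a\le n-2$, $|\nu^{(n-1)}|=\frac12(L-S_{n-1}+\lambda_n)$, $|\nu^{(n)}|=\frac12(L-S_n)$. Vacancy numbers, for $i\in\upsilon_a\mathbb Z_{>0}$: $P_i^{(a)}(\nu^\bullet)=Q_i(\nu^{(a-1)})-2Q_i(\nu^{(a)})+Q_i(\nu^{(a+1)})$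 except in the following cases: - $D^{(1)}_n$: $P^{(n-2)}_i=Q_i(\nu^{(n-3)})-2Q_i(\nu^{(n-2)})+Q_i(\nu^{(n-1)})+Q_i(\nu^{(n)})$, $P^{(a)}_i=Q_i(\nu^{(n-2)})-2Q_i(\nu^{(a)})$ for $a=n-1,n$; - $B^{(1)}_n$: $P^{(n-1)}_i=Q_i(\nu^{(n-2)})-2Q_i(\nu^{(n-1)})+2Q_i(\nu^{(n)})$, $P^{(n)}_i=2Q_i(\nu^{(n-1)})-4Q_i(\nu^{(n)})$; - $C^{(1)}_n,A^{(2)}_{2n},A^{(2)\dagger}_{2n}$: $P^{(n)}_i=Q_i(\nu^{(n-1)})-Q_i(\nu^{(n)})$; - $A^{(2)}_{2n-1}$: $P^{(n-1)}_i=Q_i(\nu^{(n-2)})-2Q_i(\nu^{(n-1)})+2Q_i(\nu^{(n)})$, $P^{(n)}_i=Q_i(\nu^{(n-1)})-2Q_i(\nu^{(n)})$; - $D^{(2)}_{n+1}$: $P^{(n)}_i=2Q_i(\nu^{(n-1)})-2Q_i(\nu^{(n)})$. *)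

theory Defs
  imports Complex_Main "HOL-Library.Multiset"
begin

text \<open>
  The seven families of affine types, each depending on a rank parameter \<open>n\<close>:
  \<open>TypeB1\<close> is \<open>B\<^sup>(\<^sup>1\<^sup>)\<^sub>n\<close>, \<open>TypeC1\<close> is \<open>C\<^sup>(\<^sup>1\<^sup>)\<^sub>n\<close>, \<open>TypeD1\<close> is \<open>D\<^sup>(\<^sup>1\<^sup>)\<^sub>n\<close>,
  \<open>TypeA2even\<close> is \<open>A\<^sup>(\<^sup>2\<^sup>)\<close> with subscript \<open>2n\<close>, \<open>TypeA2dagger\<close> its dagger version,
  \<open>TypeA2odd\<close> is \<open>A\<^sup>(\<^sup>2\<^sup>)\<close> with subscript \<open>2n - 1\<close>, and \<open>TypeD2\<close> is \<open>D\<^sup>(\<^sup>2\<^sup>)\<close> with subscript \<open>n + 1\<close>.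
\<close>

datatype affine_type =
  TypeB1 | TypeC1 | TypeD1 | TypeA2even | TypeA2dagger | TypeA2odd | TypeD2

fun min_rank :: "affine_type \<Rightarrow> nat" where
  "min_rank TypeB1 = 3"
| "min_rank TypeC1 = 2"
| "min_rank TypeD1 = 4"
| "min_rank TypeA2even = 1"
| "min_rank TypeA2dagger = 1"
| "min_rank TypeA2odd = 2"
| "min_rank TypeD2 = 2"

text \<open>
  A vector \<open>lam\<close> in \<open>\<int>\<^sup>n\<close> and a tuple \<open>\<nu>\<close> of \<open>n\<close> multisets are functions on \<open>nat\<close> of which only the
  values at \<open>1, \<dots>, n\<close> are ever used.
\<close>

definition dominant :: "affine_type \<Rightarrow> nat \<Rightarrow> (nat \<Rightarrow> int) \<Rightarrow> bool" where
  "dominant T n lam \<longleftrightarrow>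
     (\<forall>a. 1 \<le> a \<and> a < n \<longrightarrow> lam a \<ge> lam (a + 1)) \<and>
     (if T = TypeD1 then lam (n - 1) + lam n \<ge> 0 else lam n \<ge> 0)"

definition upsilon :: "affine_type \<Rightarrow> nat \<Rightarrow> nat \<Rightarrow> rat" where
  "upsilon T n a =
     (if T = TypeC1 \<and> a = n then 2 else if T = TypeB1 \<and> a = n then 1 / 2 else 1)"

definition part_values :: "affine_type \<Rightarrow> nat \<Rightarrow> nat \<Rightarrow> rat set" where
  "part_values T n a = {upsilon T n a * of_nat k | k. k > 0}"

definition psum :: "(nat \<Rightarrow> int) \<Rightarrow> nat \<Rightarrow> int" where
  "psum lam a = (\<Sum>b = 1..a. lam b)"

definition config_size :: "affine_type \<Rightarrow> nat \<Rightarrow> nat \<Rightarrow> (nat \<Rightarrow> int) \<Rightarrow> nat \<Rightarrow> rat" where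
  "config_size T n L lam a =
     (if T \<in> {TypeB1, TypeA2odd} \<and> a = n then
        (of_nat L - of_int (psum lam n)) / 2
      else if T = TypeD1 \<and> a = n - 1 then
        (of_nat L - of_int (psum lam (n - 1)) + of_int (lam n)) / 2
      else if T = TypeD1 \<and> a = n then
        (of_nat L - of_int (psum lam n)) / 2
      else of_nat L - of_int (psum lam a))"

definition is_configuration ::
    "affine_type \<Rightarrow> nat \<Rightarrow> nat \<Rightarrow> (nat \<Rightarrow> int) \<Rightarrow> (nat \<Rightarrow> rat multiset) \<Rightarrow> bool" where
  "is_configuration T n L lam \<nu> \<longleftrightarrow>
     (\<forall>a \<in> {1..n}. set_mset (\<nu> a) \<subseteq> part_values T n a \<and>
                    sum_mset (\<nu> a) = config_size T n L lam a)"

definition Q :: "rat \<Rightarrow> rat multiset \<Rightarrow> rat" where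
  "Q i \<tau> = (\<Sum>t \<in># \<tau>. min t i)"

definition with_zeroth :: "nat \<Rightarrow> (nat \<Rightarrow> rat multiset) \<Rightarrow> nat \<Rightarrow> rat multiset" where
  "with_zeroth L \<nu> a = (if a = 0 then replicate_mset L 1 else \<nu> a)"

text \<open>
  For every type the case \<open>a = n\<close> is exceptional, so for \<open>1 \<le> a \<le> n\<close> the generic formula never
  refers to \<open>\<nu> (n + 1)\<close>.
\<close>

definition vacancy ::
    "affine_type \<Rightarrow> nat \<Rightarrow> nat \<Rightarrow> (nat \<Rightarrow> rat multiset) \<Rightarrow> nat \<Rightarrow> rat \<Rightarrow> rat" where
  "vacancy T n L \<nu> a i =
     (let q = (\<lambda>b. Q i (with_zeroth L \<nu> b)) in
      if T = TypeD1 \<and> a = n - 2 then q (n - 3) - 2 * q (n - 2) + q (n - 1) + q n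
      else if T = TypeD1 \<and> a \<in> {n - 1, n} then q (n - 2) - 2 * q a
      else if T = TypeB1 \<and> a = n - 1 then q (n - 2) - 2 * q (n - 1) + 2 * q n
      else if T = TypeB1 \<and> a = n then 2 * q (n - 1) - 4 * q n
      else if T \<in> {TypeC1, TypeA2even, TypeA2dagger} \<and> a = n then q (n - 1) - q n
      else if T = TypeA2odd \<and> a = n - 1 then q (n - 2) - 2 * q (n - 1) + 2 * q n
      else if T = TypeA2odd \<and> a = n then q (n - 1) - 2 * q n
      else if T = TypeD2 \<and> a = n then 2 * q (n - 1) - 2 * q n
      else q (a - 1) - 2 * q a + q (a + 1))"

end

theory Submission
  imports Defs
begin

text \<open>
  As a function of \<open>i\<close>, a vacancy number is a difference of two functions: a sum of the concave
  functions \<open>Q i\<close> of neighbouring partitions, minus a nonnegative multiple of \<open>Q i (\<nu> a)\<close>, which is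
  affine between consecutive parts of \<open>\<nu> a\<close>. So it is concave between consecutive parts of \<open>\<nu> a\<close>.
  It vanishes at \<open>0\<close>, and for large \<open>i\<close> it is constant, equal to the pairing of \<open>lam\<close> with a simple
  coroot (up to a positive factor), which is nonnegative by dominance. Hence nonnegativity at the
  parts of \<open>\<nu> a\<close> propagates to all \<open>i \<ge> 0\<close>.
\<close>

lemma Q_union: "Q i (\<sigma> + \<tau>) = Q i \<sigma> + Q i \<tau>"
  by (simp add: Q_def)

lemma Q_zero: "(\<forall>t\<in>#\<tau>. 0 \<le> t) \<Longrightarrow> Q 0 \<tau> = 0"
  by (induction \<tau>) (auto simp: Q_def)

lemma Q_eq_sum_mset: "(\<forall>t\<in>#\<tau>. t \<le> i) \<Longrightarrow> Q i \<tau> = sum_mset \<tau>"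
  by (induction \<tau>) (auto simp: Q_def)

text \<open>The chord inequality is multiplied through by \<open>u - l\<close>, which avoids
  division and covers \<open>l = u\<close>. Both minima on the left are bounded by the branch that
  \<open>min t i\<close> takes: the constant \<open>t\<close>, or the identity.\<close>

lemma min_concave:
  fixes l i u t :: rat
  assumes "l \<le> i" "i \<le> u"
  shows "(u - i) * min t l + (i - l) * min t u \<le> (u - l) * min t i"
proof (cases "t \<le> i")
  case True
  have "(u - i) * min t l + (i - l) * min t u \<le> (u - i) * t + (i - l) * t"
    using assms by (intro add_mono mult_left_mono) auto
  also have "\<dots> = (u - l) * min t i"
    using True by (simp add: algebra_simps)
  finally show ?thesis .
next
  case False
  have "(u - i) * min t l + (i - l) * min t u \<le> (u - i) * l + (i - l) * u"
    using assms by (intro add_mono mult_left_mono) auto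
  also have "\<dots> = (u - l) * min t i"
    using False by (simp add: algebra_simps)
  finally show ?thesis .
qed

lemma Q_concave:
  assumes "l \<le> i" "i \<le> u"
  shows "(u - i) * Q l \<tau> + (i - l) * Q u \<tau> \<le> (u - l) * Q i \<tau>"
proof (induction \<tau>)
  case empty
  show ?case by (simp add: Q_def)
next
  case (add t \<tau>)
  then show ?case
    using min_concave[OF assms, of t] by (simp add: Q_def algebra_simps)
qed

text \<open>On \<open>[l, u]\<close> a part \<open>t \<le> l\<close> contributes the constant
  \<open>t\<close> and a part \<open>t \<ge> u\<close> contributes the identity, so there is no kink
  strictly inside.\<close>

lemma Q_affine_between_parts:
  assumes "l \<le> i" "i \<le> u" and "\<forall>t\<in>#\<tau>. t \<le> l \<or> u \<le> t"
  shows "(u - i) * Q l \<tau> + (i - l) * Q u \<tau> = (u - l) * Q i \<tau>"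
  using assms(3)
proof (induction \<tau>)
  case empty
  show ?case by (simp add: Q_def)
next
  case (add t \<tau>)
  have "(u - i) * min t l + (i - l) * min t u = (u - l) * min t i"
  proof (cases "t \<le> l")
    case True
    with assms(1,2) show ?thesis by (simp add: min_absorb1 algebra_simps)
  next
    case False
    with add.prems assms(1,2) show ?thesis by (simp add: min_absorb2 algebra_simps)
  qed
  with add show ?case
    by (simp add: Q_def algebra_simps)
qed

lemma Q_le_if_le_at_parts:
  assumes nonneg: "\<forall>t\<in>#\<sigma>. 0 \<le> t" "\<forall>t\<in>#\<tau>. 0 \<le> t"
    and parts: "\<forall>t\<in>#\<tau>. c * Q t \<tau> \<le> Q t \<sigma>"
    and total: "c * sum_mset \<tau> \<le> sum_mset \<sigma>"
    and "0 \<le> i"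
  shows "c * Q i \<tau> \<le> Q i \<sigma>"
proof -
  \<comment> \<open>The default \<open>0\<close> covers the case of no part up to \<open>i\<close>;
    there both sides of the goal vanish.\<close>
  define l where "l = Max (insert 0 {t \<in> set_mset \<tau>. t \<le> i})"
  have l_in: "l \<in> insert 0 {t \<in> set_mset \<tau>. t \<le> i}"
    unfolding l_def by (rule Max_in) auto
  have l_ge: "t \<le> l" if "t \<in># \<tau>" "t \<le> i" for t
    unfolding l_def using that by (intro Max_ge) auto
  have l_le: "l \<le> i"
    using l_in \<open>0 \<le> i\<close> by auto
  have l_ok: "c * Q l \<tau> \<le> Q l \<sigma>"
    using l_in parts nonneg by (auto simp: Q_zero)
  obtain u where u: "i < u" "\<forall>t\<in>#\<tau>. t \<le> i \<or> u \<le> t" "c * Q u \<tau> \<le> Q u \<sigma>"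
  proof (cases "\<exists>t\<in>#\<tau>. i < t")
    case True
    define u where "u = Min {t \<in> set_mset \<tau>. i < t}"
    have "u \<in> {t \<in> set_mset \<tau>. i < t}"
      unfolding u_def using True by (intro Min_in) auto
    moreover have "u \<le> t" if "t \<in># \<tau>" "i < t" for t
      unfolding u_def using that by (intro Min_le) auto
    ultimately show thesis
      using that[of u] parts by force
  next
    case False
    \<comment> \<open>Beyond the last part of \<open>\<tau>\<close>, \<open>u\<close> is taken past
      every part of both multisets, so that both \<open>Q u\<close> are full sums and
      \<open>total\<close> applies; \<open>i + 1\<close> forces \<open>i < u\<close>.\<close>
    define u where "u = Max (insert (i + 1) (set_mset (\<sigma> + \<tau>)))"
    have u_ge: "t \<le> u" if "t \<in> insert (i + 1) (set_mset (\<sigma> + \<tau>))" for t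
      unfolding u_def using that by (intro Max_ge) auto
    have "c * Q u \<tau> \<le> Q u \<sigma>"
      using u_ge total by (simp add: Q_eq_sum_mset)
    moreover have "i < u"
      using u_ge[of "i + 1"] by simp
    ultimately show thesis
      using that[of u] False by force
  qed
  have "\<forall>t\<in>#\<tau>. t \<le> l \<or> u \<le> t"
    using l_ge u(2) by blast
  \<comment> \<open>Affineness is an equality, so it can be scaled by \<open>c\<close>; concavity is
    spent only on \<open>\<sigma>\<close>. At the end \<open>u - l > 0\<close> cancels.\<close>
  then have "(u - l) * (c * Q i \<tau>) = c * ((u - i) * Q l \<tau> + (i - l) * Q u \<tau>)"
    using Q_affine_between_parts[of l i u \<tau>] l_le u(1) by (simp add: mult.left_commute)
  also have "\<dots> = (u - i) * (c * Q l \<tau>) + (i - l) * (c * Q u \<tau>)"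
    by (simp add: algebra_simps)
  also have "\<dots> \<le> (u - i) * Q l \<sigma> + (i - l) * Q u \<sigma>"
    using l_ok u l_le by (intro add_mono mult_left_mono) auto
  also have "\<dots> \<le> (u - l) * Q i \<sigma>"
    using l_le u by (intro Q_concave) auto
  finally show ?thesis
    using l_le u(1) by (simp add: mult_le_cancel_left)
qed

lemma psum_Suc: "psum lam (Suc a) = psum lam a + lam (Suc a)"
  by (simp add: psum_def)

lemma part_values_nonneg: "i \<in> part_values T n a \<Longrightarrow> 0 \<le> i"
  by (auto simp: part_values_def upsilon_def)

lemma with_zeroth_nonneg:
  assumes "is_configuration T n L lam \<nu>" "b \<le> n" "t \<in># with_zeroth L \<nu> b"
  shows "0 \<le> t"
proof (cases "b = 0")
  case True
  with assms show ?thesis by (auto simp: with_zeroth_def split: if_splits)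
next
  case False
  with assms have "t \<in> part_values T n b"
    by (force simp: with_zeroth_def is_configuration_def)
  then show ?thesis by (rule part_values_nonneg)
qed

text \<open>The rank bound keeps index \<open>0\<close> away from the exceptional cases of
  \<open>config_size\<close>, so the size formula extends to \<open>b = 0\<close> with value
  \<open>L\<close>.\<close>

lemma sum_mset_with_zeroth:
  assumes "n \<ge> min_rank T" "is_configuration T n L lam \<nu>" "b \<le> n"
  shows "sum_mset (with_zeroth L \<nu> b) = config_size T n L lam b"
proof (cases "b = 0")
  case True
  with assms(1) show ?thesis
    by (cases T) (auto simp: with_zeroth_def config_size_def psum_def)
next
  case False
  with assms show ?thesis
    by (auto simp: with_zeroth_def is_configuration_def)
qed

text \<open>The difference \<open>sum_mset \<sigma> - c * sum_mset (\<nu> a)\<close> is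
  \<open>lam a - lam (a + 1)\<close> for \<open>a < n\<close>. For \<open>a = n\<close> it is
  \<open>lam (n - 1) + lam n\<close> in \<open>TypeD1\<close>, and \<open>lam n\<close> or
  \<open>2 * lam n\<close> otherwise.\<close>

lemma vacancy_decomposition:
  fixes \<nu> :: "nat \<Rightarrow> rat multiset"
  assumes rank: "n \<ge> min_rank T" and dom: "dominant T n lam"
    and conf: "is_configuration T n L lam \<nu>" and a: "1 \<le> a" "a \<le> n"
  obtains \<sigma> c where "\<forall>t\<in>#\<sigma>. 0 \<le> t" "c * sum_mset (\<nu> a) \<le> sum_mset \<sigma>"
    "\<And>i. vacancy T n L \<nu> a i = Q i \<sigma> - c * Q i (\<nu> a)"
proof -
  let ?w = "with_zeroth L \<nu>"
  note nonneg = with_zeroth_nonneg[OF conf]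
  note size = sum_mset_with_zeroth[OF rank conf]
  have wa: "?w a = \<nu> a"
    using a by (simp add: with_zeroth_def)
  have step: "a < n \<Longrightarrow> lam (a + 1) \<le> lam a"
    using dom a by (simp add: dominant_def)
  have endpoint: "if T = TypeD1 then 0 \<le> lam (n - 1) + lam n else 0 \<le> lam n"
    using dom by (auto simp: dominant_def)
  \<comment> \<open>The neighbours of \<open>a\<close>; a coefficient \<open>2\<close> becomes a
    repeated summand because \<open>Q\<close> is additive.\<close>
  define \<sigma> where "\<sigma> =
     (if T = TypeD1 \<and> a = n - 2 then ?w (n - 3) + ?w (n - 1) + ?w n
      else if T = TypeD1 \<and> a \<in> {n - 1, n} then ?w (n - 2)
      else if T \<in> {TypeB1, TypeA2odd} \<and> a = n - 1 then ?w (n - 2) + ?w n + ?w n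
      else if T \<in> {TypeB1, TypeD2} \<and> a = n then ?w (n - 1) + ?w (n - 1)
      else if a = n then ?w (n - 1)
      else ?w (a - 1) + ?w (a + 1))"
  define c :: rat where "c =
     (if T \<in> {TypeC1, TypeA2even, TypeA2dagger} \<and> a = n then 1
      else if T = TypeB1 \<and> a = n then 4 else 2)"
  have vac: "vacancy T n L \<nu> a i = Q i \<sigma> - c * Q i (\<nu> a)" for i
    using rank a unfolding wa[symmetric] vacancy_def \<sigma>_def c_def Let_def
    by (cases T) (auto simp: Q_union)
  have "\<forall>t\<in>#\<sigma>. 0 \<le> t"
    using a by (auto simp: \<sigma>_def split: if_splits dest!: nonneg[rotated])
  moreover have "c * sum_mset (?w a) \<le> sum_mset \<sigma>"
  proof -
    note unfolds = \<sigma>_def c_def size config_size_def psum_Suc numeral_2_eq_2 numeral_3_eq_3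
    obtain m where m: "a = Suc m"
      using a by (cases a) auto
    let ?l = "\<lambda>b. rat_of_int (lam b)"
    have l: "?l (Suc (Suc m)) \<le> ?l (Suc m)" if "a < n"
      using step that m by simp
    \<comment> \<open>The cases follow the distance from \<open>a\<close> to \<open>n\<close>: once
      \<open>a + 3 \<le> n\<close>, the vacancy formula at \<open>a\<close> and the sizes at
      \<open>a\<close> and \<open>a + 1\<close> are all generic. Successor forms let the simplifier
      decide the index comparisons.\<close>
    consider (D) "n = a" "T = TypeD1" | (last) "n = a" "T \<noteq> TypeD1"
      | "n = Suc a" | "n = Suc (Suc a)" | "a + 3 \<le> n"
      using a by linarith
    then show ?thesis
    proof cases
      case D
      then obtain k where k: "m = Suc k"
        using rank m by (cases m) auto
      have "0 \<le> ?l (Suc k) + ?l (Suc (Suc k))"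
        using endpoint D m k by (simp flip: of_int_add)
      then show ?thesis
        by (simp add: unfolds m k D field_simps)
    next
      case last
      have "0 \<le> ?l (Suc m)"
        using endpoint last m by simp
      then show ?thesis
        using rank last(2)
        by (cases T) (simp_all add: unfolds m last(1) field_simps)
    next
      case 3
      then have l': "?l (Suc (Suc m)) \<le> ?l (Suc m)"
        using l by simp
      show ?thesis
        using rank l'
        by (cases T) (simp_all add: unfolds m 3 field_simps)
    next
      case 4
      then have l': "?l (Suc (Suc m)) \<le> ?l (Suc m)"
        using l by simp
      show ?thesis
        using rank l'
        by (cases T) (simp_all add: unfolds m 4 field_simps)
    next
      case 5
      then obtain k where "n = a + 3 + k"
        using le_Suc_ex by blast
      then have k: "n = Suc (Suc (Suc (a + k)))"
        by simp
      then have l': "?l (Suc (Suc m)) \<le> ?l (Suc m)"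
        using l by simp
      show ?thesis
        using rank l'
        by (cases T) (simp_all add: unfolds m k field_simps)
    qed
  qed
  ultimately show thesis
    using that vac wa by simp
qed

theorem lemma5p3:
  fixes T :: affine_type and n L :: nat
    and lam :: "nat \<Rightarrow> int" and \<nu> :: "nat \<Rightarrow> rat multiset"
  assumes "n \<ge> min_rank T"
    and "dominant T n lam"
    and "is_configuration T n L lam \<nu>"
  shows "(\<forall>a \<in> {1..n}. \<forall>i \<in> part_values T n a. vacancy T n L \<nu> a i \<ge> 0) \<longleftrightarrow>
         (\<forall>a \<in> {1..n}. \<forall>i \<in> part_values T n a. count (\<nu> a) i > 0 \<longrightarrow> vacancy T n L \<nu> a i \<ge> 0)"
proof (intro iffI ballI)
  fix a i
  assume parts: "\<forall>a \<in> {1..n}. \<forall>i \<in> part_values T n a.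
      count (\<nu> a) i > 0 \<longrightarrow> vacancy T n L \<nu> a i \<ge> 0"
    and a: "a \<in> {1..n}" and i: "i \<in> part_values T n a"
  have sub: "set_mset (\<nu> a) \<subseteq> part_values T n a"
    using assms(3) a by (simp add: is_configuration_def)
  obtain \<sigma> c where \<sigma>: "\<forall>t\<in>#\<sigma>. 0 \<le> t" "c * sum_mset (\<nu> a) \<le> sum_mset \<sigma>"
    and vac: "\<And>i. vacancy T n L \<nu> a i = Q i \<sigma> - c * Q i (\<nu> a)"
    using vacancy_decomposition[OF assms] a by auto
  have "c * Q i (\<nu> a) \<le> Q i \<sigma>"
  proof (rule Q_le_if_le_at_parts[OF \<sigma>(1) _ _ \<sigma>(2)])
    show "\<forall>t\<in>#\<nu> a. 0 \<le> t"
      using sub part_values_nonneg by blast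
    \<comment> \<open>Every part of \<open>\<nu> a\<close> is an admissible index of positive
      multiplicity, so condition 2 applies to it.\<close>
    show "\<forall>t\<in>#\<nu> a. c * Q t (\<nu> a) \<le> Q t \<sigma>"
      using parts a sub vac by fastforce
    show "0 \<le> i"
      using i by (rule part_values_nonneg)
  qed
  then show "vacancy T n L \<nu> a i \<ge> 0"
    by (simp add: vac)
qed blast

end
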